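(* Let $n\ge 4$ be an integer and let $A$ be the triangle inequality constraint matrix on $n$ points. Then $A$ has exactly three distinct singular values: $\sqrt{3n-4}$, $\sqrt{2n-2}$ and $\sqrt{n-2}$, with multiplicities $\frac{n(n-3)}{2}$, $n-1$ and $1$ respectively.
   Context: The singular values of $A$ are the square roots of the eigenvalues of $A^\top A$ (an $\binom n2\times\binom n2$ matrix), counted with multiplicity. Let $\mathbb{I}=\{(i,j):1\le i<j\le n\}$. The triangle inequality constraint matrix $A$ encodes the triangle inequalities $D_{i,k}-D_{i,j}-D_{j,k}\le 0$ for a symmetric array of distances $D$ among $n$ points: its columns are indexed by $\mathbb{I}$ (the column $(i,j)$ represents the distance $D_{i,j}=D_{j,i}$); its rows are indexed by the triangle inequalities, one for each choice of an unordered pair $\{i,k\}$ of distinct points and a third point $j\notin\{i,k\}$ (so there are three rows for each 3-element subset of points). The row of the inequality $D_{i,k}-D_{i,j}-D_{j,k}\le0$ has entry $+1$ in the column of the pair $\{i,k\}$, entry $-1$ in the columns of the pairs $\{i,j\}$ and $\{j,k\}$, and $0$ in all other columns. *)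

theory Defs
  imports
    Complex_Main
    "HOL-Library.Multiset"
    "HOL-Computational_Algebra.Polynomial"
    "Jordan_Normal_Form.Char_Poly"
begin

(* proots lists the real roots of the characteristic polynomial with their multiplicities.
   Restricting to real roots loses nothing, since transpose_mat A * A is symmetric. *)
definition singular_values :: "real mat \<Rightarrow> real multiset" where
  "singular_values A = image_mset sqrt (proots (char_poly (transpose_mat A * A)))"

definition point_pairs :: "nat \<Rightarrow> (nat \<times> nat) set" where
  "point_pairs n = {(i, j). 1 \<le> i \<and> i < j \<and> j \<le> n}"

(* (i, j, k) stands for D i k - D i j - D j k <= 0. The unordered pair {i, k} is represented
   with i < k, so that each inequality occurs exactly once; j may lie anywhere. *)
definition triangle_inequalities :: "nat \<Rightarrow> (nat \<times> nat \<times> nat) set" where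
  "triangle_inequalities n =
     {(i, j, k). 1 \<le> i \<and> i < k \<and> k \<le> n \<and> 1 \<le> j \<and> j \<le> n \<and> j \<noteq> i \<and> j \<noteq> k}"

fun triangle_entry :: "nat \<times> nat \<times> nat \<Rightarrow> nat \<times> nat \<Rightarrow> real" where
  "triangle_entry (i, j, k) (a, b) =
     (if {a, b} = {i, k} then 1
      else if {a, b} = {i, j} \<or> {a, b} = {j, k} then -1
      else 0)"

(* A library matrix is indexed by initial segments of nat, so the index sets have to be listed
   in some order; rs and cs enumerate the rows and the columns. *)
definition triangle_matrix :: "(nat \<times> nat \<times> nat) list \<Rightarrow> (nat \<times> nat) list \<Rightarrow> real mat" where
  "triangle_matrix rs cs =
     mat (length rs) (length cs) (\<lambda>(r, c). triangle_entry (rs ! r) (cs ! c))"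

definition is_triangle_inequality_matrix :: "nat \<Rightarrow> real mat \<Rightarrow> bool" where
  "is_triangle_inequality_matrix n A \<longleftrightarrow>
     (\<exists>rs cs. distinct rs \<and> set rs = triangle_inequalities n \<and>
              distinct cs \<and> set cs = point_pairs n \<and>
              A = triangle_matrix rs cs)"

end

theory Submission
  imports Defs
begin

text \<open>
  Write $B$ for the incidence matrix of points and pairs ($n$ rows and $m = n(n-1)/2$ columns).
  Two distinct columns of $A$ share a nonzero row only if the pairs have a point in common; then
  exactly the three rows of one triangle contribute, with products $-1, -1, +1$. A column has
  $3(n-2)$ entries $\pm 1$. Since $B^T B$ counts common points,
  $A^T A = (3n-4) I - B^T B$ (\<open>triangle_gram_incidence\<close>).

  In the other order, $B B^T = (n-2) I + J$ with $J$ the all-ones matrix, because a point lies in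
  $n-1$ pairs and two points in exactly one. Sylvester's identity
  (\<open>sylvester_determinant\<close>) transfers the characteristic polynomial from $B B^T$ to $B^T B$,
  and it also evaluates $\det(zI + J)$, as $J$ is a column times a row of ones. Hence $B^T B$ has the
  eigenvalues $2n-2$ (once), $n-2$ ($n-1$ times) and $0$ ($m - n = n(n-3)/2$ times), and subtracting
  them from $3n-4$ gives the spectrum of $A^T A$.
\<close>

section \<open>Determinants of scalar plus product\<close>

text \<open>
  Both sides come from one block matrix $M$ with rows $(yI, C)$ and $(-D, I)$: multiplying it on the
  right by a block triangular matrix clears either the lower left or the upper right block. The
  powers of $y$ keep the identity free of division, so it holds in every integral domain and also
  at $y = 0$.
\<close>

lemma sylvester_determinant:
  fixes C D :: "'a :: idom mat"
  assumes C: "C \<in> carrier_mat m k" and D: "D \<in> carrier_mat k m"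
  shows "y ^ k * det (y \<cdot>\<^sub>m 1\<^sub>m m + C * D) = y ^ m * det (y \<cdot>\<^sub>m 1\<^sub>m k + D * C)"
proof -
  define M where "M = four_block_mat (y \<cdot>\<^sub>m 1\<^sub>m m) C (- D) (1\<^sub>m k)"
  define L where "L = four_block_mat (1\<^sub>m m) (0\<^sub>m m k) D (1\<^sub>m k)"
  define R where "R = four_block_mat (1\<^sub>m m) (- C) (0\<^sub>m k m) (y \<cdot>\<^sub>m 1\<^sub>m k)"
  note carriers = C D mult_carrier_mat[OF C D] mult_carrier_mat[OF D C]
  have M: "M \<in> carrier_mat (m + k) (m + k)" and L: "L \<in> carrier_mat (m + k) (m + k)"
    and R: "R \<in> carrier_mat (m + k) (m + k)"
    unfolding M_def L_def R_def using C D by (intro four_block_carrier_mat; simp)+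
  have "M * L = four_block_mat (y \<cdot>\<^sub>m 1\<^sub>m m * 1\<^sub>m m + C * D) (y \<cdot>\<^sub>m 1\<^sub>m m * 0\<^sub>m m k + C * 1\<^sub>m k)
      (- D * 1\<^sub>m m + 1\<^sub>m k * D) (- D * 0\<^sub>m m k + 1\<^sub>m k * 1\<^sub>m k)"
    unfolding M_def L_def using C D by (intro mult_four_block_mat) auto
  also have "\<dots> = four_block_mat (y \<cdot>\<^sub>m 1\<^sub>m m + C * D) C (0\<^sub>m k m) (1\<^sub>m k)"
    using C D by (intro arg_cong4[of _ _ _ _ _ _ _ _ four_block_mat]) auto
  finally have "det (M * L) = det (y \<cdot>\<^sub>m 1\<^sub>m m + C * D)"
    using carriers by (subst (asm) eq_commute)
      (metis add_carrier_mat det_four_block_mat_lower_left_zero det_one mult.right_neutral one_carrier_mat)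
  moreover have "det L = 1"
    unfolding L_def using D by (subst det_four_block_mat_upper_right_zero[of _ m _ k]) auto
  ultimately have M_left: "det M = det (y \<cdot>\<^sub>m 1\<^sub>m m + C * D)"
    using det_mult[OF M L] by simp
  have "M * R = four_block_mat (y \<cdot>\<^sub>m 1\<^sub>m m * 1\<^sub>m m + C * 0\<^sub>m k m) (y \<cdot>\<^sub>m 1\<^sub>m m * (- C) + C * (y \<cdot>\<^sub>m 1\<^sub>m k))
      (- D * 1\<^sub>m m + 1\<^sub>m k * 0\<^sub>m k m) (- D * (- C) + 1\<^sub>m k * (y \<cdot>\<^sub>m 1\<^sub>m k))"
    unfolding M_def R_def using C D by (intro mult_four_block_mat) auto
  also have "\<dots> = four_block_mat (y \<cdot>\<^sub>m 1\<^sub>m m) (0\<^sub>m m k) (- D) (y \<cdot>\<^sub>m 1\<^sub>m k + D * C)"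
  proof (intro arg_cong4[of _ _ _ _ _ _ _ _ four_block_mat])
    have "y \<cdot>\<^sub>m 1\<^sub>m m * (- C) = - (y \<cdot>\<^sub>m C)"
      using C by (subst mult_smult_assoc_mat[of _ m m _ k]) (auto intro: eq_matI)
    then show "y \<cdot>\<^sub>m 1\<^sub>m m * (- C) + C * (y \<cdot>\<^sub>m 1\<^sub>m k) = 0\<^sub>m m k"
      using C by (auto simp: mult_smult_distrib[of _ m k _ k])
    show "- D * (- C) + 1\<^sub>m k * (y \<cdot>\<^sub>m 1\<^sub>m k) = y \<cdot>\<^sub>m 1\<^sub>m k + D * C"
      using C D by (auto intro!: eq_matI)
  qed (use C D in auto)
  finally have "det (M * R) = det (y \<cdot>\<^sub>m 1\<^sub>m m) * det (y \<cdot>\<^sub>m 1\<^sub>m k + D * C)"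
    using carriers by (simp add: det_four_block_mat_upper_right_zero[of _ m _ k])
  moreover have "det R = y ^ k"
    unfolding R_def using C by (subst det_four_block_mat_lower_left_zero[of _ m _ k]) auto
  ultimately show ?thesis
    using det_mult[OF M R] M_left by (simp add: mult.commute)
qed

lemma det_scalar_plus_all_ones:
  fixes z :: "'a :: idom"
  shows "z * det (z \<cdot>\<^sub>m 1\<^sub>m n + mat n n (\<lambda>_. 1)) = z ^ n * (z + of_nat n)"
proof -
  let ?u = "mat n 1 (\<lambda>_. 1) :: 'a mat" and ?v = "mat 1 n (\<lambda>_. 1) :: 'a mat"
  have "?u * ?v = mat n n (\<lambda>_. 1)"
    by (intro eq_matI) (auto simp: scalar_prod_def)
  moreover have "det (z \<cdot>\<^sub>m 1\<^sub>m 1 + ?v * ?u) = z + of_nat n"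
    by (subst det_single) (auto simp: scalar_prod_def)
  ultimately show ?thesis
    using sylvester_determinant[of ?u n 1 ?v z] by simp
qed

section \<open>Counting triangle rows\<close>

definition incidence :: "nat \<Rightarrow> nat \<times> nat \<Rightarrow> real" where
  "incidence v p = of_bool (v = fst p \<or> v = snd p)"

text \<open>
  The encoded row of the triangle inequality $D_{x,y} \<le> D_{x,j} + D_{j,y}$ for $x$, $y$ in either
  order; it allows choosing the third point of a triangle without distinguishing its position in the
  ordering of the points.
\<close>

definition apex_row :: "nat \<Rightarrow> nat \<Rightarrow> nat \<Rightarrow> nat \<times> nat \<times> nat" where
  "apex_row j x y = (min x y, j, max x y)"

lemma apex_row_entry:
  assumes "j \<noteq> x" "j \<noteq> y" "x \<noteq> y"
  shows "triangle_entry (apex_row j x y) (c, d)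
    = of_bool ({c, d} = {x, y}) - of_bool ({c, d} = {x, j}) - of_bool ({c, d} = {j, y})"
  using assms by (auto simp: apex_row_def min_def max_def doubleton_eq_iff)

lemma finite_triangle_inequalities: "finite (triangle_inequalities n)"
  by (rule finite_subset[of _ "{..n} \<times> {..n} \<times> {..n}"]) (auto simp: triangle_inequalities_def)

lemma finite_point_pairs: "finite (point_pairs n)"
  by (rule finite_subset[of _ "{..n} \<times> {..n}"]) (auto simp: point_pairs_def)

lemma apex_row_mem:
  assumes "{j, x, y} \<subseteq> {1..n}" "j \<noteq> x" "j \<noteq> y" "x \<noteq> y"
  shows "apex_row j x y \<in> triangle_inequalities n"
  using assms by (auto simp: apex_row_def triangle_inequalities_def min_def max_def)

text \<open>
  The rows with a nonzero entry in column $\{a,b\}$ belong to the triangles $\{a,b,c\}$. In each of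
  these the entry is $+1$ if the apex is $c$ and $-1$ if the apex is $a$ or $b$. This turns a scalar
  product with that column into a sum over the third point $c$.
\<close>

lemma sum_rows_through_pair:
  fixes g :: "nat \<times> nat \<times> nat \<Rightarrow> real"
  assumes ab: "(a, b) \<in> point_pairs n"
  shows "(\<Sum>t\<in>triangle_inequalities n. triangle_entry t (a, b) * g t)
    = (\<Sum>c\<in>{1..n} - {a, b}. g (apex_row c a b) - g (apex_row a b c) - g (apex_row b a c))"
proof -
  let ?T = "triangle_inequalities n" and ?C = "{1..n} - {a, b}"
  have a: "1 \<le> a" "a < b" "b \<le> n" using ab by (auto simp: point_pairs_def)
  let ?X = "(\<lambda>c. apex_row c a b) ` ?C"
  let ?Y = "(\<lambda>c. apex_row a b c) ` ?C"
  let ?Z = "(\<lambda>c. apex_row b a c) ` ?C"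
  have sub: "?X \<subseteq> ?T" "?Y \<subseteq> ?T" "?Z \<subseteq> ?T"
    using a by (auto intro!: apex_row_mem)
  have X: "(i, j, k) \<in> ?X \<longleftrightarrow> {a, b} = {i, k}"
    and Y: "(i, j, k) \<in> ?Y \<longleftrightarrow> j = a \<and> (i = b \<or> k = b)"
    and Z: "(i, j, k) \<in> ?Z \<longleftrightarrow> j = b \<and> (i = a \<or> k = a)"
    if t: "(i, j, k) \<in> ?T" for i j k
  proof -
    show "(i, j, k) \<in> ?X \<longleftrightarrow> {a, b} = {i, k}"
      using t a by (auto simp: apex_row_def triangle_inequalities_def image_iff doubleton_eq_iff)
    have "j = a \<and> (i = b \<or> k = b)" if "(i, j, k) \<in> ?Y"
      using that by (auto simp: apex_row_def min_def max_def split: if_splits)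
    moreover have "(i, j, k) \<in> ?Y" if "j = a" "i = b \<or> k = b"
      using that t by (intro image_eqI[of _ _ "if i = b then k else i"])
        (auto simp: apex_row_def triangle_inequalities_def)
    ultimately show "(i, j, k) \<in> ?Y \<longleftrightarrow> j = a \<and> (i = b \<or> k = b)"
      by blast
    have "j = b \<and> (i = a \<or> k = a)" if "(i, j, k) \<in> ?Z"
      using that by (auto simp: apex_row_def min_def max_def split: if_splits)
    moreover have "(i, j, k) \<in> ?Z" if "j = b" "i = a \<or> k = a"
      using that t by (intro image_eqI[of _ _ "if i = a then k else i"])
        (auto simp: apex_row_def triangle_inequalities_def)
    ultimately show "(i, j, k) \<in> ?Z \<longleftrightarrow> j = b \<and> (i = a \<or> k = a)"
      by blast
  qed
  have entry: "triangle_entry t (a, b) = of_bool (t \<in> ?X) - of_bool (t \<in> ?Y) - of_bool (t \<in> ?Z)"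
    if "t \<in> ?T" for t
  proof -
    obtain i j k where t: "t = (i, j, k)" by (cases t)
    show ?thesis
      using that a unfolding t X[OF that[unfolded t]] Y[OF that[unfolded t]] Z[OF that[unfolded t]]
      by (auto simp: triangle_inequalities_def doubleton_eq_iff)
  qed
  have select: "(\<Sum>t\<in>?T. of_bool (t \<in> S) * g t) = sum g S" if "S \<subseteq> ?T" for S
    using that by (intro sum.mono_neutral_cong_right finite_triangle_inequalities) auto
  have "(\<Sum>t\<in>?T. triangle_entry t (a, b) * g t)
      = (\<Sum>t\<in>?T. of_bool (t \<in> ?X) * g t - of_bool (t \<in> ?Y) * g t - of_bool (t \<in> ?Z) * g t)"
    by (intro sum.cong refl) (simp only: entry left_diff_distrib)
  also have "\<dots> = sum g ?X - sum g ?Y - sum g ?Z"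
    by (simp only: sum_subtractf select[OF sub(1)] select[OF sub(2)] select[OF sub(3)])
  also have "\<dots> = (\<Sum>c\<in>?C. g (apex_row c a b)) - (\<Sum>c\<in>?C. g (apex_row a b c)) - (\<Sum>c\<in>?C. g (apex_row b a c))"
  proof -
    have "inj_on (\<lambda>c. apex_row c a b) ?C" "inj_on (\<lambda>c. apex_row a b c) ?C" "inj_on (\<lambda>c. apex_row b a c) ?C"
      by (auto simp: inj_on_def apex_row_def min_def max_def split: if_splits)
    then show ?thesis by (simp add: sum.reindex)
  qed
  finally show ?thesis by (simp add: sum_subtractf)
qed

text \<open>
  Per triangle $\{a,b,v\}$ the signed sum of three entries in column $q$ is $3$ if $q = \{a,b\}$ and
  $-1$ if $q$ is one of the other two sides. Such a side occurs once for every point that $q$ shares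
  with $p = \{a,b\}$, unless $q = p$; the number of shared points absorbs this exception when the
  coefficient $3(n-2)$ of the diagonal is replaced by $3n-4$.
\<close>

lemma triangle_gram_entry:
  assumes n: "n \<ge> 2" and p: "p \<in> point_pairs n" and q: "q \<in> point_pairs n"
  shows "(\<Sum>t\<in>triangle_inequalities n. triangle_entry t p * triangle_entry t q)
    = (3 * real n - 4) * of_bool (p = q) - (\<Sum>v = 1..n. incidence v p * incidence v q)"
proof -
  obtain a b c d where pq: "p = (a, b)" "q = (c, d)" by fastforce
  have ord: "1 \<le> a" "a < b" "b \<le> n" "1 \<le> c" "c < d" "d \<le> n"
    using p q by (auto simp: pq point_pairs_def)
  let ?C = "{1..n} - {a, b}"
  have card: "card ?C = n - 2"
    using ord by (subst card_Diff_subset) auto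
  have "(\<Sum>t\<in>triangle_inequalities n. triangle_entry t p * triangle_entry t q)
      = (\<Sum>v\<in>?C. triangle_entry (apex_row v a b) q - triangle_entry (apex_row a b v) q
          - triangle_entry (apex_row b a v) q)"
    unfolding pq using p by (intro sum_rows_through_pair) (simp add: pq)
  also have "\<dots> = (\<Sum>v\<in>?C. 3 * of_bool (p = q) - of_bool ({c, d} = {a, v}) - of_bool ({c, d} = {b, v}))"
    using ord unfolding pq
    by (intro sum.cong refl) (auto simp: apex_row_entry doubleton_eq_iff)
  \<comment> \<open>For $v$ outside $p$: $q$ is $\{a,v\}$ or $\{b,v\}$ iff it contains $v$ and meets $p$.\<close>
  also have "\<dots> = (\<Sum>v\<in>?C. 3 * of_bool (p = q) - incidence v q * (incidence a q + incidence b q))"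
    using ord unfolding pq
    by (intro sum.cong refl) (auto simp: incidence_def doubleton_eq_iff)
  also have "\<dots> = 3 * real (n - 2) * of_bool (p = q)
      - (\<Sum>v\<in>?C. incidence v q) * (incidence a q + incidence b q)"
    using card by (simp add: sum_subtractf sum_distrib_right)
  also have "(\<Sum>v\<in>?C. incidence v q) = (\<Sum>v = 1..n. incidence v q) - incidence a q - incidence b q"
    using ord by (subst sum_diff) auto
  also have "(\<Sum>v = 1..n. incidence v q) = 2"
  proof -
    have "{1..n} \<inter> {v. v = c \<or> v = d} = {c, d}" using ord by auto
    then show ?thesis using ord by (simp add: incidence_def pq of_bool_def sum.If_cases)
  qed
  \<comment> \<open>With $s = |p \cap q|$ this is $(2-s)s = s - 2[p = q]$, checked for $s = 0, 1, 2$.\<close>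
  also have "3 * real (n - 2) * of_bool (p = q)
      - (2 - incidence a q - incidence b q) * (incidence a q + incidence b q)
      = (3 * real n - 4) * of_bool (p = q) - (incidence a q + incidence b q)"
    using n ord by (auto simp: pq incidence_def of_nat_diff algebra_simps)
  also have "incidence a q + incidence b q = (\<Sum>v = 1..n. incidence v p * incidence v q)"
  proof -
    have "(\<Sum>v = 1..n. incidence v p * incidence v q) = (\<Sum>v \<in> {a, b}. incidence v q)"
      using ord by (intro sum.mono_neutral_cong_right) (auto simp: incidence_def pq)
    then show ?thesis using ord by simp
  qed
  finally show ?thesis .
qed

lemma sum_incidence_square:
  assumes "v \<in> {1..n}"
  shows "(\<Sum>p\<in>point_pairs n. incidence v p * incidence v p) = real (n - 1)"
proof -
  let ?S = "(\<lambda>u. (min u v, max u v)) ` ({1..n} - {v})"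
  have "p \<in> ?S" if p: "p \<in> point_pairs n" "v = fst p \<or> v = snd p" for p
    using p by (intro image_eqI[of _ _ "if v = fst p then snd p else fst p"])
      (auto simp: point_pairs_def)
  moreover have "p \<in> point_pairs n \<and> (v = fst p \<or> v = snd p)" if p: "p \<in> ?S" for p
  proof -
    obtain u where "p = (min u v, max u v)" "u \<in> {1..n} - {v}" using p by blast
    then show ?thesis using assms by (cases "u < v") (auto simp: point_pairs_def)
  qed
  ultimately have S: "{p \<in> point_pairs n. v = fst p \<or> v = snd p} = ?S" by blast
  have "(\<Sum>p\<in>point_pairs n. incidence v p * incidence v p)
      = (\<Sum>p\<in>point_pairs n. if v = fst p \<or> v = snd p then 1 else 0)"
    by (intro sum.cong) (auto simp: incidence_def)
  also have "\<dots> = real (card ?S)"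
    unfolding S[symmetric] using finite_point_pairs[of n] by (simp add: sum.If_cases Int_def)
  also have "card ?S = card ({1..n} - {v})"
    by (intro card_image) (auto simp: inj_on_def min_def max_def split: if_splits)
  finally show ?thesis using assms by simp
qed

lemma incidence_gram_entry:
  assumes "v \<in> {1..n}" "w \<in> {1..n}"
  shows "(\<Sum>p\<in>point_pairs n. incidence v p * incidence w p)
    = (real n - 2) * of_bool (v = w) + 1"
proof (cases "v = w")
  case True
  then show ?thesis using sum_incidence_square[OF assms(1)] assms by (simp add: of_nat_diff)
next
  case False
  have "(\<Sum>p\<in>point_pairs n. incidence v p * incidence w p) = (\<Sum>p\<in>{(min v w, max v w)}. 1)"
    using assms False by (intro sum.mono_neutral_cong_right finite_point_pairs)
      (auto simp: incidence_def point_pairs_def min_def max_def split: if_splits)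
  then show ?thesis using False by simp
qed

lemma card_point_pairs: "2 * card (point_pairs n) = n * (n - 1)"
proof -
  have "point_pairs n = (\<lambda>(j, i). (i, j)) ` (SIGMA j:{..n}. {1..<j})"
    by (auto simp: point_pairs_def image_iff)
  then have "card (point_pairs n) = (\<Sum>j\<le>n. j - 1)"
    by (simp add: card_image inj_on_def)
  moreover have "2 * (\<Sum>j\<le>n. j - 1) = n * (n - 1)"
    by (induction n) (auto simp: algebra_simps)
  ultimately show ?thesis by simp
qed

lemma sum_nth_distinct:
  assumes "distinct xs"
  shows "(\<Sum>i = 0..<length xs. f (xs ! i)) = sum f (set xs)"
  using sum.reindex_bij_betw[OF bij_betw_nth[OF assms refl refl], of f] by (simp add: atLeast0LessThan)

section \<open>The spectrum of the Gram matrix\<close>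

text \<open>
  Matrix rows are numbered from $0$ while the points are $1, \ldots, n$; hence the successor in the
  definition of $B$.
\<close>

lemma triangle_gram_incidence:
  fixes n :: nat and cs :: "(nat \<times> nat) list"
  defines "B \<equiv> mat n (length cs) (\<lambda>(v, c). incidence (Suc v) (cs ! c))"
  assumes n: "n \<ge> 2"
    and rs: "distinct rs" "set rs = triangle_inequalities n"
    and cs: "distinct cs" "set cs = point_pairs n"
    and A: "A = triangle_matrix rs cs"
  shows "transpose_mat A * A = (3 * real n - 4) \<cdot>\<^sub>m 1\<^sub>m (length cs) - transpose_mat B * B"
    and "B * transpose_mat B = (real n - 2) \<cdot>\<^sub>m 1\<^sub>m n + mat n n (\<lambda>_. 1)"
proof -
  have entry: "(transpose_mat A * A) $$ (c, d)
      = (3 * real n - 4) * of_bool (c = d) - (transpose_mat B * B) $$ (c, d)"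
    if "c < length cs" "d < length cs" for c d
  proof -
    have "(transpose_mat A * A) $$ (c, d)
        = (\<Sum>r = 0..<length rs. triangle_entry (rs ! r) (cs ! c) * triangle_entry (rs ! r) (cs ! d))"
      using that by (simp add: A triangle_matrix_def scalar_prod_def)
    also have "\<dots> = (\<Sum>t\<in>triangle_inequalities n. triangle_entry t (cs ! c) * triangle_entry t (cs ! d))"
      unfolding rs(2)[symmetric]
      using sum_nth_distinct[OF rs(1), of "\<lambda>t. triangle_entry t (cs ! c) * triangle_entry t (cs ! d)"] .
    also have "\<dots> = (3 * real n - 4) * of_bool (cs ! c = cs ! d)
        - (\<Sum>v = 1..n. incidence v (cs ! c) * incidence v (cs ! d))"
      using that cs nth_mem by (intro triangle_gram_entry n) blast+
    also have "(cs ! c = cs ! d) = (c = d)"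
      using that cs(1) by (simp add: nth_eq_iff_index_eq)
    also have "(\<Sum>v = 1..n. incidence v (cs ! c) * incidence v (cs ! d)) = (transpose_mat B * B) $$ (c, d)"
      using that by (simp add: B_def scalar_prod_def sum.atLeast1_atMost_eq atLeast0LessThan)
    finally show ?thesis .
  qed
  show "transpose_mat A * A = (3 * real n - 4) \<cdot>\<^sub>m 1\<^sub>m (length cs) - transpose_mat B * B"
  proof (rule eq_matI)
    show "dim_row (transpose_mat A * A) = dim_row ((3 * real n - 4) \<cdot>\<^sub>m 1\<^sub>m (length cs) - transpose_mat B * B)"
      "dim_col (transpose_mat A * A) = dim_col ((3 * real n - 4) \<cdot>\<^sub>m 1\<^sub>m (length cs) - transpose_mat B * B)"
      by (simp_all add: A triangle_matrix_def B_def)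
    have dims: "dim_row (transpose_mat B * B) = length cs" "dim_col (transpose_mat B * B) = length cs"
      by (simp_all add: B_def)
    fix c d
    assume "c < dim_row ((3 * real n - 4) \<cdot>\<^sub>m 1\<^sub>m (length cs) - transpose_mat B * B)"
      and "d < dim_col ((3 * real n - 4) \<cdot>\<^sub>m 1\<^sub>m (length cs) - transpose_mat B * B)"
    then have "c < length cs" "d < length cs" using dims by simp_all
    then show "(transpose_mat A * A) $$ (c, d)
        = ((3 * real n - 4) \<cdot>\<^sub>m 1\<^sub>m (length cs) - transpose_mat B * B) $$ (c, d)"
      unfolding entry[OF \<open>c < length cs\<close> \<open>d < length cs\<close>] using dims
      by (simp del: index_mult_mat)
  qed
  show "B * transpose_mat B = (real n - 2) \<cdot>\<^sub>m 1\<^sub>m n + mat n n (\<lambda>_. 1)"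
  proof (rule eq_matI)
    fix v w
    assume "v < dim_row ((real n - 2) \<cdot>\<^sub>m 1\<^sub>m n + mat n n (\<lambda>_. 1))"
      and "w < dim_col ((real n - 2) \<cdot>\<^sub>m 1\<^sub>m n + mat n n (\<lambda>_. 1))"
    then have vw: "v < n" "w < n" by auto
    have "(B * transpose_mat B) $$ (v, w)
        = (\<Sum>c = 0..<length cs. incidence (Suc v) (cs ! c) * incidence (Suc w) (cs ! c))"
      using vw by (simp add: B_def scalar_prod_def)
    also have "\<dots> = (\<Sum>p\<in>point_pairs n. incidence (Suc v) p * incidence (Suc w) p)"
      unfolding cs(2)[symmetric]
      using sum_nth_distinct[OF cs(1), of "\<lambda>p. incidence (Suc v) p * incidence (Suc w) p"] .
    also have "\<dots> = (real n - 2) * of_bool (v = w) + 1"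
      using vw by (subst incidence_gram_entry) auto
    finally show "(B * transpose_mat B) $$ (v, w) = ((real n - 2) \<cdot>\<^sub>m 1\<^sub>m n + mat n n (\<lambda>_. 1)) $$ (v, w)"
      using vw by simp
  qed (auto simp: B_def)
qed

text \<open>
  Evaluated at $x$, the characteristic polynomial is $\det(yI + B^T B)$ with $y = x - (3n-4)$. Sylvester's
  identity yields it multiplied by $y^n z$, where $z = y + n - 2 = x - (2n-2)$. This factor vanishes at
  two points, so it is cancelled only after passing from values to polynomials. The hypothesis
  $n \<ge> 3$ ensures $m \<ge> n$.
\<close>

lemma char_poly_triangle_gram:
  assumes n: "n \<ge> 3" and A: "is_triangle_inequality_matrix n A"
  shows "char_poly (transpose_mat A * A)
    = [:- (3 * real n - 4), 1:] ^ (n * (n - 3) div 2) * [:- (2 * real n - 2), 1:] ^ (n - 1)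
        * [:- (real n - 2), 1:]"
    (is "?P = ?Y ^ ?k * ?Z ^ (n - 1) * ?W")
proof -
  obtain rs cs where rs: "distinct rs" "set rs = triangle_inequalities n"
    and cs: "distinct cs" "set cs = point_pairs n" and A: "A = triangle_matrix rs cs"
    using A by (auto simp: is_triangle_inequality_matrix_def)
  define m where "m = length cs"
  define B where "B = mat n m (\<lambda>(v, c). incidence (Suc v) (cs ! c))"
  have B: "B \<in> carrier_mat n m" by (simp add: B_def)
  have gram: "transpose_mat A * A = (3 * real n - 4) \<cdot>\<^sub>m 1\<^sub>m m - transpose_mat B * B"
    "B * transpose_mat B = (real n - 2) \<cdot>\<^sub>m 1\<^sub>m n + mat n n (\<lambda>_. 1)"
    using triangle_gram_incidence[OF _ rs cs A] n by (simp_all add: B_def m_def)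
  have "m = card (point_pairs n)" using cs by (simp add: m_def flip: distinct_card)
  then have "2 * m = n * (n - 1)" using card_point_pairs by simp
  moreover have "n * (n - 1) = n * (n - 3) + 2 * n"
    using n by (simp add: algebra_simps diff_mult_distrib2)
  ultimately have m: "m = n + ?k" by presburger
  have "?Y ^ n * ?Z * ?P = ?Y ^ m * ?Z ^ n * ?W"
  proof (rule poly_ext)
    fix x :: real
    define y where "y = x - (3 * real n - 4)"
    define z where "z = x - (2 * real n - 2)"
    have "poly ?P x = det (y \<cdot>\<^sub>m 1\<^sub>m m + transpose_mat B * B)"
    proof -
      have "transpose_mat A * A \<in> carrier_mat m m"
        unfolding gram(1) using B by (intro minus_carrier_mat) auto
      moreover have "- char_matrix (transpose_mat A * A) x = y \<cdot>\<^sub>m 1\<^sub>m m + transpose_mat B * B"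
        unfolding char_matrix_def gram(1) using B
        by (intro eq_matI) (auto simp: y_def)
      ultimately show ?thesis by (simp add: char_poly_matrix)
    qed
    moreover have "y ^ n * det (y \<cdot>\<^sub>m 1\<^sub>m m + transpose_mat B * B)
        = y ^ m * det (y \<cdot>\<^sub>m 1\<^sub>m n + B * transpose_mat B)"
      using B by (intro sylvester_determinant) auto
    moreover have "y \<cdot>\<^sub>m 1\<^sub>m n + B * transpose_mat B = z \<cdot>\<^sub>m 1\<^sub>m n + mat n n (\<lambda>_. 1)"
      unfolding gram(2) by (intro eq_matI) (auto simp: y_def z_def)
    ultimately have "y ^ n * z * poly ?P x = y ^ m * z ^ n * (z + real n)"
      using det_scalar_plus_all_ones[of z n] by (simp add: ac_simps)
    then show "poly (?Y ^ n * ?Z * ?P) x = poly (?Y ^ m * ?Z ^ n * ?W) x"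
      by (simp add: y_def z_def algebra_simps)
  qed
  also have "\<dots> = ?Y ^ n * ?Z * (?Y ^ ?k * ?Z ^ (n - 1) * ?W)"
  proof -
    have "?Z ^ n = ?Z * ?Z ^ (n - 1)" using n by (simp only: power_eq_if[of _ n]) simp
    then show ?thesis by (simp only: m power_add ac_simps)
  qed
  finally have "?Y ^ n * ?Z * ?P = ?Y ^ n * ?Z * (?Y ^ ?k * ?Z ^ (n - 1) * ?W)" .
  moreover have "?Y ^ n * ?Z \<noteq> 0"
    by (simp only: mult_eq_0_iff power_eq_0_iff) simp
  ultimately show ?thesis
    using mult_left_cancel[of "?Y ^ n * ?Z" ?P "?Y ^ ?k * ?Z ^ (n - 1) * ?W"] by fast
qed

theorem mainTheorem8:
  fixes n :: nat and A :: "real mat"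
  assumes "n \<ge> 4"
    and "is_triangle_inequality_matrix n A"
  shows "set_mset (singular_values A)
           = {sqrt (3 * real n - 4), sqrt (2 * real n - 2), sqrt (real n - 2)}
         \<and> card (set_mset (singular_values A)) = 3
         \<and> count (singular_values A) (sqrt (3 * real n - 4)) = n * (n - 3) div 2
         \<and> count (singular_values A) (sqrt (2 * real n - 2)) = n - 1
         \<and> count (singular_values A) (sqrt (real n - 2)) = 1"
proof -
  let ?k = "n * (n - 3) div 2"
  have sv: "singular_values A = repeat_mset ?k {#sqrt (3 * real n - 4)#}
      + repeat_mset (n - 1) {#sqrt (2 * real n - 2)#} + {#sqrt (real n - 2)#}"
  proof -
    have "proots (char_poly (transpose_mat A * A)) = repeat_mset ?k {#3 * real n - 4#}
        + repeat_mset (n - 1) {#2 * real n - 2#} + {#real n - 2#}"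
      using char_poly_triangle_gram[of n A] assms
      by (simp add: proots_mult proots_power del: mult_pCons_left mult_pCons_right)
    then show ?thesis
      by (simp add: singular_values_def)
  qed
  \<comment> \<open>This is where $n \<ge> 4$ enters: for $n = 3$ the value $\sqrt{3n-4}$ does not occur.\<close>
  have k: "?k > 0"
  proof -
    have "4 * 1 \<le> n * (n - 3)" using assms(1) by (intro mult_le_mono) auto
    then show ?thesis by simp
  qed
  have ne: "sqrt (3 * real n - 4) \<noteq> sqrt (2 * real n - 2)"
    "sqrt (3 * real n - 4) \<noteq> sqrt (real n - 2)" "sqrt (2 * real n - 2) \<noteq> sqrt (real n - 2)"
    using assms(1) by auto
  have "set_mset (singular_values A) = {sqrt (3 * real n - 4), sqrt (2 * real n - 2), sqrt (real n - 2)}"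
    using k assms(1) by (auto simp: sv)
  then show ?thesis using ne by (simp add: sv)
qed

end
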